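(* For every tree $T$, the zero forcing graph $\mathscr{Z}(T)$ is $\{C_3,C_4\}$-free if and only if $T$ is a path.
   Context: All graphs are finite, simple and undirected (with nonempty vertex set). Zero forcing: vertices of a graph $G$ are colored blue or white; the color change rule says that a blue vertex $u$ can change the color of a white vertex $w$ to blue if $w$ is the unique white neighbor of $u$. A set $B\subseteq V(G)$ is a zero forcing set of $G$ if, starting with exactly the vertices of $B$ blue and applying the color change rule repeatedly, all vertices eventually become blue. The zero forcing number $\operatorname{Z}(G)$ is the minimum of $|B|$ over all zero forcing sets $B$ of $G$; a minimum zero forcing set is a zero forcing set $B$ with $|B|=\operatorname{Z}(G)$. The zero forcing graph $\mathscr{Z}(G)$ is the graph whose vertices are the minimum zero forcing sets of $G$, with $B$ and $B'$ adjacent if and only if the symmetric difference of $B$ and $B'$ has exactly two elements. $C_n$ denotes the cycle on $n$ vertices; a graph is $\{C_3,C_4\}$-free if it contains neither $C_3$ nor $C_4$ as a subgraph (for this pair of cycles, this is equivalent to containing neither as an induced subgraph). A single vertex counts as a path. *)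

theory Defs
  imports "Graph_Theory.Graph_Theory"
begin

text \<open>
  A finite simple undirected graph is a \<^locale>\<open>pair_graph\<close>: each undirected edge is represented
  by its two opposite arcs.
\<close>

definition path_graph :: "nat \<Rightarrow> nat pair_pre_digraph" where
  "path_graph n = \<lparr> pverts = {..<n},
     parcs = {(i, j). i < n \<and> j < n \<and> (j = i + 1 \<or> i = j + 1)} \<rparr>"

text \<open>The cycle on \<open>n\<close> vertices; only meant for \<open>n \<ge> 3\<close>.\<close>

definition cycle_graph :: "nat \<Rightarrow> nat pair_pre_digraph" where
  "cycle_graph n = \<lparr> pverts = {..<n},
     parcs = {(i, j). i < n \<and> j < n \<and> (j = (i + 1) mod n \<or> i = (j + 1) mod n)} \<rparr>"

text \<open>\<open>G\<close> contains \<open>H\<close> as a (not necessarily induced) subgraph, up to isomorphism.\<close>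

definition contains_subgraph :: "'a pair_pre_digraph \<Rightarrow> 'b pair_pre_digraph \<Rightarrow> bool" where
  "contains_subgraph G H \<longleftrightarrow>
     (\<exists>H'. subgraph (with_proj H') (with_proj G) \<and> digraph_iso (with_proj H) (with_proj H'))"

text \<open>
  The predicates \<^const>\<open>forest\<close> and \<^const>\<open>tree\<close> of the library are not usable here: they count the
  two opposite arcs of a single edge as a directed cycle. Note that \<^const>\<open>connected\<close> includes
  nonemptiness of the vertex set.
\<close>

definition is_tree :: "'a pair_pre_digraph \<Rightarrow> bool" where
  "is_tree T \<longleftrightarrow> pair_graph T \<and> connected (with_proj T) \<and>
     (\<forall>n\<ge>3. \<not> contains_subgraph T (cycle_graph n))"

definition is_path :: "'a pair_pre_digraph \<Rightarrow> bool" where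
  "is_path G \<longleftrightarrow> (\<exists>n\<ge>1. digraph_iso (with_proj (path_graph n)) (with_proj G))"

text \<open>One application of the color change rule; a coloring is given by its set of blue vertices.\<close>

inductive color_change :: "'a pair_pre_digraph \<Rightarrow> 'a set \<Rightarrow> 'a set \<Rightarrow> bool" for G where
  "u \<in> S \<Longrightarrow> {x. (u, x) \<in> parcs G \<and> x \<notin> S} = {w} \<Longrightarrow> color_change G S (insert w S)"

definition zero_forcing_set :: "'a pair_pre_digraph \<Rightarrow> 'a set \<Rightarrow> bool" where
  "zero_forcing_set G B \<longleftrightarrow> B \<subseteq> pverts G \<and> (color_change G)\<^sup>*\<^sup>* B (pverts G)"

definition zero_forcing_number :: "'a pair_pre_digraph \<Rightarrow> nat" where
  "zero_forcing_number G = (LEAST k. \<exists>B. zero_forcing_set G B \<and> card B = k)"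

definition min_zero_forcing_set :: "'a pair_pre_digraph \<Rightarrow> 'a set \<Rightarrow> bool" where
  "min_zero_forcing_set G B \<longleftrightarrow> zero_forcing_set G B \<and> card B = zero_forcing_number G"

definition zero_forcing_graph :: "'a pair_pre_digraph \<Rightarrow> 'a set pair_pre_digraph" where
  "zero_forcing_graph G = \<lparr> pverts = {B. min_zero_forcing_set G B},
     parcs = {(B, B'). min_zero_forcing_set G B \<and> min_zero_forcing_set G B' \<and>
                       card ((B - B') \<union> (B' - B)) = 2} \<rparr>"

lemma digraph_iso_with_proj_iff:
  assumes "pair_wf_digraph G"
  shows "digraph_iso (with_proj G) (with_proj H) \<longleftrightarrow>
    (\<exists>f. inj_on f (pverts G) \<and> pverts H = f ` pverts G \<and> parcs H = map_prod f f ` parcs G)"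
    (is "?L \<longleftrightarrow> ?R")
proof
  interpret pair_wf_digraph G by fact
  assume ?L
  then obtain h where h: "pre_digraph.digraph_isomorphism (with_proj G) h"
    and H: "with_proj H = app_iso h (with_proj G)"
    by (auto simp: digraph_iso_def)
  have ends: "iso_tail h = fst" "iso_head h = snd"
    using arg_cong[OF H, of tail] arg_cong[OF H, of head] by simp_all
  have "iso_arcs h a = map_prod (iso_verts h) (iso_verts h) a" if "a \<in> parcs G" for a
    using h that by (cases a) (auto simp: pre_digraph.digraph_isomorphism_def ends prod_eq_iff)
  then have "iso_arcs h ` parcs G = map_prod (iso_verts h) (iso_verts h) ` parcs G"
    by (rule image_cong[OF refl])
  moreover have "pverts H = iso_verts h ` pverts G" "parcs H = iso_arcs h ` parcs G"
    using arg_cong[OF H, of verts] arg_cong[OF H, of arcs] by simp_all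
  ultimately show ?R
    using h by (auto simp: pre_digraph.digraph_isomorphism_def)
next
  interpret pair_wf_digraph G by fact
  assume ?R
  then obtain f where f: "inj_on f (pverts G)" "pverts H = f ` pverts G"
    "parcs H = map_prod f f ` parcs G"
    by blast
  let ?h = "\<lparr> iso_verts = f, iso_arcs = map_prod f f, iso_head = snd, iso_tail = fst \<rparr>"
  have "inj_on (map_prod f f) (parcs G)"
  proof (rule inj_on_subset)
    show "inj_on (map_prod f f) (pverts G \<times> pverts G)"
      by (rule map_prod_inj_on[OF f(1) f(1)])
    show "parcs G \<subseteq> pverts G \<times> pverts G"
      by (auto dest: in_arcsD1 in_arcsD2)
  qed
  moreover have "wf_digraph (with_proj G)"
    by (rule wf_digraph)
  ultimately have "pre_digraph.digraph_isomorphism (with_proj G) ?h"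
    using f(1) by (simp add: pre_digraph.digraph_isomorphism_def)
  moreover have "with_proj H = app_iso ?h (with_proj G)"
    using f by (simp add: app_iso_def with_proj_def)
  ultimately show ?L
    unfolding digraph_iso_def by blast
qed

lemma pair_graph_path_graph: "pair_graph (path_graph n)"
proof
  have "parcs (path_graph n) \<subseteq> {..<n} \<times> {..<n}"
    by (auto simp: path_graph_def)
  then show "finite (parcs (path_graph n))"
    by (rule finite_subset) simp
qed (auto simp: path_graph_def symmetric_def sym_def)

lemma pair_graph_cycle_graph:
  assumes "n \<ge> 3"
  shows "pair_graph (cycle_graph n)"
proof
  have "parcs (cycle_graph n) \<subseteq> {..<n} \<times> {..<n}"
    by (auto simp: cycle_graph_def)
  then show "finite (parcs (cycle_graph n))"
    by (rule finite_subset) simp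
qed (use assms in \<open>auto simp: cycle_graph_def symmetric_def sym_def mod_Suc split: if_splits\<close>)

lemma pair_graph_zero_forcing_graph:
  assumes "pair_graph G"
  shows "pair_graph (zero_forcing_graph G)"
proof -
  interpret pair_graph G by fact
  let ?Z = "zero_forcing_graph G"
  have "pverts ?Z \<subseteq> Pow (pverts G)"
    by (auto simp: zero_forcing_graph_def min_zero_forcing_set_def zero_forcing_set_def)
  then have fin: "finite (pverts ?Z)"
    by (rule finite_subset) (simp add: pair_finite_verts)
  have "parcs ?Z \<subseteq> pverts ?Z \<times> pverts ?Z"
    by (auto simp: zero_forcing_graph_def)
  then have "finite (parcs ?Z)"
    by (rule finite_subset) (simp add: fin)
  with fin show ?thesis
    by unfold_locales (auto simp: zero_forcing_graph_def symmetric_def sym_def Un_commute)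
qed

end

theory Submission
  imports Defs
begin

text \<open>
  In a tree, the sources of any oriented path cover form a zero forcing set, and conversely the
  forcing chains of a zero forcing set form such a cover; hence the sources of a cover with the
  fewest paths form a minimum zero forcing set, and reversing one of its paths exchanges one
  endpoint for the other. If a minimum cover has two nontrivial paths, reversing them
  independently gives a \<open>C\<^sub>4\<close>. If it has a trivial path \<open>v\<close> next to another path with endpoints
  \<open>s\<close> and \<open>t\<close>, any two of \<open>s\<close>, \<open>t\<close>, \<open>v\<close> can be used together with the remaining sources, which
  gives a \<open>C\<^sub>3\<close>. If it consists of a single path, so does the tree. On a path the only minimum
  zero forcing sets are the two endpoints.
\<close>

section \<open>Subgraphs isomorphic to a cycle\<close>

lemma contains_cycleI:
  assumes "pair_graph G" "n \<ge> 3" "inj_on f {..<n}"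
    and arcs: "\<And>i. i < n \<Longrightarrow> (f i, f (Suc i mod n)) \<in> parcs G"
  shows "contains_subgraph G (cycle_graph n)"
proof -
  interpret pair_graph G by fact
  interpret C: pair_graph "cycle_graph n" by (rule pair_graph_cycle_graph) fact
  define H where "H = \<lparr>pverts = f ` {..<n}, parcs = map_prod f f ` parcs (cycle_graph n)\<rparr>"
  have iso: "digraph_iso (with_proj (cycle_graph n)) (with_proj H)"
    unfolding digraph_iso_with_proj_iff[OF C.pair_wf_digraph_axioms]
    using assms(3) by (auto simp: H_def cycle_graph_def)
  have verts: "f i \<in> pverts G" if "i < n" for i
    using arcs[OF that] by (rule in_arcsD1)
  have "pair_wf_digraph H"
    by unfold_locales (auto simp: H_def cycle_graph_def)
  moreover have "parcs H \<subseteq> parcs G"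
    using arcs arcs[THEN arcs_symmetric] by (auto simp: H_def cycle_graph_def)
  moreover have "pverts H \<subseteq> pverts G"
    using verts by (auto simp: H_def)
  ultimately have "subgraph (with_proj H) (with_proj G)"
    unfolding subgraph_def by (auto simp: wf_digraph_wp_iff wf_digraph)
  with iso show ?thesis
    unfolding contains_subgraph_def by blast
qed

text \<open>Serves to exhibit explicit short cycles; appending \<open>hd xs\<close> makes the
  closing arc part of the walk.\<close>

lemma contains_cycle_listI:
  assumes "pair_graph G" "length xs \<ge> 3" "distinct xs"
    and "successively (\<lambda>x y. (x, y) \<in> parcs G) (xs @ [hd xs])"
  shows "contains_subgraph G (cycle_graph (length xs))"
proof (rule contains_cycleI)
  show "inj_on ((!) xs) {..<length xs}"
    using assms(3) by (rule inj_on_nth) auto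
  have "xs \<noteq> []"
    using assms(2) by auto
  then show "(xs ! i, xs ! (Suc i mod length xs)) \<in> parcs G" if "i < length xs" for i
    using assms(4) that by (cases "Suc i = length xs")
      (auto simp: successively_conv_nth nth_append hd_conv_nth dest: spec[of _ i])
qed fact+

text \<open>A copy of the cycle needs \<open>n\<close> distinct vertices. This keeps cycles out of a
  zero forcing graph with at most two vertices.\<close>

lemma contains_cycleD:
  assumes "contains_subgraph G (cycle_graph n)" "n \<ge> 3" "finite (pverts G)"
  shows "n \<le> card (pverts G)"
proof -
  interpret C: pair_graph "cycle_graph n" by (rule pair_graph_cycle_graph) fact
  obtain H where H: "subgraph (with_proj H) (with_proj G)"
    "digraph_iso (with_proj (cycle_graph n)) (with_proj H)"
    using assms(1) by (auto simp: contains_subgraph_def)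
  then obtain f where f: "inj_on f {..<n}" "pverts H = f ` {..<n}"
    unfolding digraph_iso_with_proj_iff[OF C.pair_wf_digraph_axioms]
    by (auto simp: cycle_graph_def)
  have "f ` {..<n} \<subseteq> pverts G"
    using H(1) f(2) by (auto simp: subgraph_def)
  from card_mono[OF assms(3) this] show ?thesis
    by (simp add: card_image[OF f(1)])
qed

section \<open>Forests and their oriented path covers\<close>

locale pair_forest = pair_graph G for G :: "'a pair_pre_digraph" +
  assumes no_cycle: "n \<ge> 3 \<Longrightarrow> \<not> contains_subgraph G (cycle_graph n)"
begin

text \<open>An arc from the end back to the start would close the path to a cycle of length
  \<open>n\<close>.\<close>

lemma no_closed_path:
  assumes "inj_on f {..<n}" "n \<ge> 3" "\<And>i. Suc i < n \<Longrightarrow> (f i, f (Suc i)) \<in> parcs G"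
  shows "(f (n - 1), f 0) \<notin> parcs G"
proof
  assume "(f (n - 1), f 0) \<in> parcs G"
  then have "(f i, f (Suc i mod n)) \<in> parcs G" if "i < n" for i
    using that assms(2,3) by (cases "Suc i = n") auto
  then show False
    using no_cycle contains_cycleI[OF pair_graph_axioms assms(2,1)] assms(2) by blast
qed

text \<open>
  Such a set \<open>A\<close> would allow an infinite walk that never turns back; the first vertex
  that it repeats closes a cycle.
\<close>
lemma non_backtracking_empty:
  assumes "A \<subseteq> parcs G"
    and step: "\<And>x y. (x, y) \<in> A \<Longrightarrow> \<exists>z. z \<noteq> x \<and> (y, z) \<in> A"
  shows "A = {}"
proof (rule ccontr)
  assume "A \<noteq> {}"
  then obtain a where "a \<in> A" by auto
  \<comment> \<open>One further step of the walk. The choice is meaningful only for arcs in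
    \<open>A\<close>, where \<open>step\<close> provides a candidate.\<close>
  define next_arc where "next_arc a = (snd a, SOME z. z \<noteq> fst a \<and> (snd a, z) \<in> A)" for a
  have next_arc: "next_arc a \<in> A \<and> fst (next_arc a) = snd a \<and> snd (next_arc a) \<noteq> fst a"
    if "a \<in> A" for a
    using someI_ex[OF step[of "fst a" "snd a"]] that by (auto simp: next_arc_def)
  define x where "x i = fst ((next_arc ^^ i) a)" for i
  have in_A: "(next_arc ^^ i) a \<in> A" for i
    by (induction i) (use \<open>a \<in> A\<close> next_arc in auto)
  have x_Suc: "x (Suc i) = snd ((next_arc ^^ i) a)" for i
    using next_arc[OF in_A] by (simp add: x_def)
  have arc: "(x i, x (Suc i)) \<in> parcs G" for i
    using in_A[of i] assms(1) unfolding x_Suc by (auto simp: x_def)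
  have turn: "x (Suc (Suc i)) \<noteq> x i" for i
    using next_arc[OF in_A[of i]] by (simp add: x_Suc) (simp add: x_def)
  have "range x \<subseteq> pverts G"
    using arc by (auto dest: in_arcsD1)
  then have "\<not> inj x"
    using finite_subset[OF _ pair_finite_verts] finite_imageD[of x UNIV] by auto
  then have "\<exists>j. \<exists>i<j. x i = x j"
    by (metis injI linorder_neqE_nat)
  \<comment> \<open>Taking the earliest repetition makes \<open>x\<close> injective on the stretch
    before \<open>j\<close>.\<close>
  then obtain j where j: "\<exists>i<j. x i = x j" and least: "\<And>k i. k < j \<Longrightarrow> i < k \<Longrightarrow> x i \<noteq> x k"
    using exists_least_iff[of "\<lambda>j. \<exists>i<j. x i = x j"] by blast
  then obtain i where i: "i < j" "x i = x j" by blast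
  \<comment> \<open>A return after one step would be a loop, after two steps a turn back.\<close>
  have "j \<noteq> Suc i" "j \<noteq> Suc (Suc i)"
    using i(2) arc[of i] turn[of i] pair_no_loops by force+
  then have "j - i \<ge> 3"
    using i(1) by linarith
  moreover have "inj_on (\<lambda>k. x (i + k)) {..<j - i}"
    by (rule linorder_inj_onI) (use least in auto)
  ultimately have "(x (i + (j - i - 1)), x i) \<notin> parcs G"
    using no_closed_path[of "\<lambda>k. x (i + k)" "j - i"] arc by simp
  then show False
    using arc[of "j - 1"] i by simp
qed

text \<open>
  The components of such an arc set \<open>F\<close> are directed paths covering all vertices; directed
  cycles are ruled out because \<open>G\<close> is a forest.
\<close>
definition path_cover :: "('a \<times> 'a) set \<Rightarrow> bool" where
  "path_cover F \<longleftrightarrow> F \<subseteq> parcs G \<and> single_valued F \<and> single_valued (F\<inverse>) \<and>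
     (\<forall>x y. (x, y) \<in> F \<longrightarrow> (y, x) \<notin> F)"

text \<open>The start vertices of the paths. A vertex on no arc of \<open>F\<close> is a trivial
  path, hence both a source and a sink.\<close>

definition sources :: "('a \<times> 'a) set \<Rightarrow> 'a set" where
  "sources F = pverts G - Range F"

definition sinks :: "('a \<times> 'a) set \<Rightarrow> 'a set" where
  "sinks F = pverts G - Domain F"

lemma path_coverD:
  assumes "path_cover F"
  shows "F \<subseteq> parcs G" "finite F" "\<And>x y. (x, y) \<in> F \<Longrightarrow> (y, x) \<notin> F"
    "\<And>x y z. (x, y) \<in> F \<Longrightarrow> (x, z) \<in> F \<Longrightarrow> y = z"
    "\<And>x y z. (y, x) \<in> F \<Longrightarrow> (z, x) \<in> F \<Longrightarrow> y = z"
    "\<And>x y. (x, y) \<in> F \<Longrightarrow> x \<in> pverts G \<and> y \<in> pverts G"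
  using assms finite_subset[OF _ pair_finite_arcs]
  by (auto simp: path_cover_def single_valued_def dest: in_arcsD1 in_arcsD2)

text \<open>Each vertex that is not a source is the head of exactly one arc of \<open>F\<close>. So
  having the fewest paths amounts to having the most arcs.\<close>

lemma card_sources:
  assumes "path_cover F"
  shows "card (sources F) + card F = card (pverts G)"
proof -
  note F = path_coverD[OF assms]
  have "inj_on snd F"
    using F(5) by (force intro: inj_onI)
  then have "card (Range F) = card F"
    by (simp add: card_image Range_snd)
  moreover have "Range F \<subseteq> pverts G"
    using F(6) by auto
  ultimately show ?thesis
    unfolding sources_def using pair_finite_verts
    by (metis card_Diff_subset card_mono finite_subset le_add_diff_inverse2)
qed

text \<open>The arcs on directed cycles of \<open>F\<close> can be followed forever, and without
  turning back since \<open>F\<close> has no two opposite arcs; so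
  \<open>non_backtracking_empty\<close> applies to them.\<close>

lemma path_cover_acyclic:
  assumes "path_cover F"
  shows "acyclic F"
proof -
  note F = path_coverD[OF assms]
  define A where "A = {(x, y). (x, y) \<in> F \<and> (y, x) \<in> F\<^sup>*}"
  have "A = {}"
  proof (rule non_backtracking_empty)
    show "A \<subseteq> parcs G"
      using F(1) by (auto simp: A_def)
  next
    fix x y assume "(x, y) \<in> A"
    then have xy: "(x, y) \<in> F" "(y, x) \<in> F\<^sup>*" by (auto simp: A_def)
    then have "x \<noteq> y" using F(3) by auto
    then obtain z where z: "(y, z) \<in> F" "(z, x) \<in> F\<^sup>*"
      using xy(2) by (auto elim: converse_rtranclE)
    then show "\<exists>z. z \<noteq> x \<and> (y, z) \<in> A"
      using xy(1) F(3) unfolding A_def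
      by (metis (mono_tags, lifting) case_prodI mem_Collect_eq rtrancl.rtrancl_into_rtrancl)
  qed
  show ?thesis
  proof (rule acyclicI, intro allI notI)
    fix x assume "(x, x) \<in> F\<^sup>+"
    then obtain y where "(x, y) \<in> F" "(y, x) \<in> F\<^sup>*"
      by (auto dest: tranclD)
    with \<open>A = {}\<close> show False by (auto simp: A_def)
  qed
qed

lemma path_cover_source:
  assumes "path_cover F" "v \<in> pverts G"
  obtains s where "s \<in> sources F" "(s, v) \<in> F\<^sup>*"
proof -
  note F = path_coverD[OF assms(1)]
  have "wf F"
    using F(2) path_cover_acyclic[OF assms(1)] by (rule finite_acyclic_wf)
  then have "v \<in> pverts G \<longrightarrow> (\<exists>s\<in>sources F. (s, v) \<in> F\<^sup>*)"
  proof (induction v rule: wf_induct_rule)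
    case (less v)
    show ?case
    proof (cases "v \<in> Range F")
      case True
      then obtain u where "(u, v) \<in> F" by auto
      with less F(6) show ?thesis
        by (meson rtrancl_into_rtrancl)
    qed (auto simp: sources_def)
  qed
  with assms(2) that show thesis by blast
qed

lemma source_rtrancl:
  assumes "s \<in> sources F" "(x, s) \<in> F\<^sup>*"
  shows "x = s"
  using assms(2,1) by (cases rule: rtranclE) (auto simp: sources_def)

subsection \<open>Path covers and zero forcing sets\<close>

lemma color_change_subset:
  assumes "(color_change G)\<^sup>*\<^sup>* S S'"
  shows "S \<subseteq> S'" "S \<subseteq> pverts G \<Longrightarrow> S' \<subseteq> pverts G"
  using assms by (induction) (auto simp: color_change.simps dest: in_arcsD2)

text \<open>A reachable coloring with the most blue vertices admits no further force.\<close>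

lemma exists_stalled:
  assumes "B \<subseteq> pverts G"
  obtains S where "(color_change G)\<^sup>*\<^sup>* B S" "B \<subseteq> S" "S \<subseteq> pverts G"
    "\<And>u w. u \<in> S \<Longrightarrow> {x. (u, x) \<in> parcs G \<and> x \<notin> S} \<noteq> {w}"
proof -
  define P where "P S \<longleftrightarrow> (color_change G)\<^sup>*\<^sup>* B S" for S
  have P: "S \<subseteq> pverts G" "B \<subseteq> S" if "P S" for S
    using color_change_subset[of B S] that assms by (simp_all add: P_def)
  then have bound: "card S \<le> card (pverts G)" if "P S" for S
    using card_mono[OF pair_finite_verts] that by blast
  have "P B" by (simp add: P_def)
  from ex_has_greatest_nat[of P, OF this, of card "Suc (card (pverts G))"] bound
  obtain S where S: "P S" "\<And>S'. P S' \<Longrightarrow> card S' \<le> card S"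
    by (auto simp: less_Suc_eq_le)
  have "{x. (u, x) \<in> parcs G \<and> x \<notin> S} \<noteq> {w}" if "u \<in> S" for u w
  proof
    assume *: "{x. (u, x) \<in> parcs G \<and> x \<notin> S} = {w}"
    then have "P (insert w S)"
      using S(1) color_change.intros[OF that *] unfolding P_def by (metis rtranclp.rtrancl_into_rtrancl)
    moreover have "card (insert w S) = Suc (card S)"
      using * finite_subset[OF P(1)[OF S(1)] pair_finite_verts] by (subst card_insert_disjoint) auto
    ultimately show False
      using S(2) by (metis Suc_n_not_le_n)
  qed
  then show thesis
    using that S(1) P[OF S(1)] by (simp add: P_def)
qed

text \<open>
  If the forcing process stalls with white vertices left, walk from a white vertex back along
  its path until a blue vertex is reached; the latter has another white neighbour, from
  which the walk continues in the same way, never turning back.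
\<close>
lemma zero_forcing_sources:
  assumes "path_cover F"
  shows "zero_forcing_set G (sources F)"
proof -
  note F = path_coverD[OF assms]
  obtain S where S: "(color_change G)\<^sup>*\<^sup>* (sources F) S" "sources F \<subseteq> S" "S \<subseteq> pverts G"
    "\<And>u w. u \<in> S \<Longrightarrow> {x. (u, x) \<in> parcs G \<and> x \<notin> S} \<noteq> {w}"
    using exists_stalled[of "sources F"] by (auto simp: sources_def)
  \<comment> \<open>The first set contains the steps from a white vertex back to its predecessor.
    The second contains the steps from a blue vertex whose successor \<open>w\<close> is white to
    another white neighbour \<open>w'\<close>.\<close>
  define A where "A = {(w, p). (p, w) \<in> F \<and> w \<notin> S} \<union>
    {(u, w'). (u, w') \<in> parcs G \<and> u \<in> S \<and> w' \<notin> S \<and> (\<exists>w. w \<noteq> w' \<and> (u, w) \<in> F \<and> w \<notin> S)}"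
  have pred: "\<exists>p. (p, w) \<in> F" if "w \<notin> S" "w \<in> pverts G" for w
    using that S(2) by (auto simp: sources_def)
  have "A = {}"
  proof (rule non_backtracking_empty)
    show "A \<subseteq> parcs G"
      using F(1) by (auto simp: A_def dest: arcs_symmetric)
  next
    fix x y assume "(x, y) \<in> A"
    then consider (up) "(y, x) \<in> F" "x \<notin> S"
      | (turn) w where "(x, y) \<in> parcs G" "x \<in> S" "y \<notin> S" "w \<noteq> y" "(x, w) \<in> F" "w \<notin> S"
      by (auto simp: A_def)
    then show "\<exists>z. z \<noteq> x \<and> (y, z) \<in> A"
    proof cases
      case up
      show ?thesis
      proof (cases "y \<in> S")
        case True
        \<comment> \<open>As the process has stalled, \<open>x\<close> is not the only white
          neighbour of \<open>y\<close>.\<close>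
        have "{z. (y, z) \<in> parcs G \<and> z \<notin> S} \<noteq> {x}"
          using S(4)[OF True] .
        then obtain z where "(y, z) \<in> parcs G" "z \<notin> S" "z \<noteq> x"
          using up F(1) by blast
        with True up show ?thesis by (auto simp: A_def)
      next
        case False
        then obtain p where "(p, y) \<in> F"
          using pred F(6) up by blast
        moreover have "p \<noteq> x"
          using F(3) up(1) \<open>(p, y) \<in> F\<close> by blast
        ultimately show ?thesis
          using False by (auto simp: A_def)
      qed
    next
      case turn
      then obtain p where "(p, y) \<in> F"
        using pred by (meson in_arcsD2)
      moreover have "p \<noteq> x"
        using F(4) turn(4,5) \<open>(p, y) \<in> F\<close> by blast
      ultimately show ?thesis
        using turn(3) by (auto simp: A_def)
    qed
  qed
  \<comment> \<open>A white vertex is not a source, so it has a predecessor and would contribute an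
    arc to \<open>A\<close>.\<close>
  then have "S = pverts G"
    using pred S(3) by (auto simp: A_def)
  with S(1) show ?thesis
    by (auto simp: zero_forcing_set_def sources_def)
qed

text \<open>Each force contributes the arc from the forcing vertex to the forced one.\<close>

lemma zero_forcing_set_path_cover:
  assumes "zero_forcing_set G B"
  obtains F where "path_cover F" "sources F = B"
proof -
  have B: "B \<subseteq> pverts G" and "(color_change G)\<^sup>*\<^sup>* B (pverts G)"
    using assms by (auto simp: zero_forcing_set_def)
  \<comment> \<open>Invariant of the process with current coloring \<open>S\<close>. By its last
    conjunct a vertex that has forced has no white neighbour left, so it never forces again and
    \<open>F\<close> stays single-valued.\<close>
  from this(2) have "\<exists>F. path_cover F \<and> F \<subseteq> S \<times> S \<and> Range F = S - B \<and>
    (\<forall>u w x. (u, w) \<in> F \<longrightarrow> (u, x) \<in> parcs G \<longrightarrow> x \<in> S)" if "S = pverts G" for S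
    unfolding that[symmetric]
  proof (induction rule: rtranclp_induct)
    case base
    show ?case
      by (rule exI[of _ "{}"]) (auto simp: path_cover_def)
  next
    case (step S S')
    then obtain F where F: "path_cover F" "F \<subseteq> S \<times> S" "Range F = S - B"
      "\<And>u w x. (u, w) \<in> F \<Longrightarrow> (u, x) \<in> parcs G \<Longrightarrow> x \<in> S"
      by blast
    from step.hyps(2) obtain u w where u: "u \<in> S" "{x. (u, x) \<in> parcs G \<and> x \<notin> S} = {w}"
      and S': "S' = insert w S"
      by (auto simp: color_change.simps)
    have w: "(u, w) \<in> parcs G" "w \<notin> S" "\<And>x. (u, x) \<in> parcs G \<Longrightarrow> x \<in> insert w S"
      using u(2) by auto
    have "w \<notin> B"
      using w(2) color_change_subset(1)[OF step.hyps(1)] by auto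
    have "path_cover (insert (u, w) F)"
      using F(1,2) F(4)[of u _ w] u(1) w(1,2) by (auto simp: path_cover_def single_valued_def)
    moreover have "Range (insert (u, w) F) = S' - B"
      using F(3) \<open>w \<notin> B\<close> by (auto simp: S')
    ultimately show ?case
      using F(2,4) u(1) w(3) unfolding S'
      by (intro exI[of _ "insert (u, w) F"]) blast
  qed
  from this[OF refl] obtain F where "path_cover F" "Range F = pverts G - B"
    by auto
  with B that show thesis
    by (auto simp: sources_def double_diff)
qed

subsection \<open>Maximum path covers\<close>

text \<open>By \<open>card_sources\<close> these are the covers with the fewest paths.\<close>

definition max_cover :: "('a \<times> 'a) set \<Rightarrow> bool" where
  "max_cover F \<longleftrightarrow> path_cover F \<and> (\<forall>F'. path_cover F' \<longrightarrow> card F' \<le> card F)"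

lemma max_coverD:
  assumes "max_cover F"
  shows "path_cover F" "\<And>F'. path_cover F' \<Longrightarrow> card F' \<le> card F"
  using assms by (auto simp: max_cover_def)

lemma max_cover_card_eq:
  "max_cover F \<Longrightarrow> path_cover F' \<Longrightarrow> card F' = card F \<Longrightarrow> max_cover F'"
  by (auto simp: max_cover_def)

lemma exists_max_cover: obtains F where "max_cover F"
proof -
  have "path_cover {}"
    by (simp add: path_cover_def)
  moreover have "card F < Suc (card (parcs G))" if "path_cover F" for F
    using card_mono[OF pair_finite_arcs path_coverD(1)[OF that]] by simp
  ultimately have "\<exists>F. path_cover F \<and> (\<forall>F'. path_cover F' \<longrightarrow> card F' \<le> card F)"
    using ex_has_greatest_nat[of path_cover "{}" card "Suc (card (parcs G))"] by simp
  with that show thesis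
    by (auto simp: max_cover_def)
qed

text \<open>Every zero forcing set is the source set of some cover, which has at most as many arcs
  as \<open>F\<close> and hence at least as many sources.\<close>

lemma min_zero_forcing_set_sources:
  assumes "max_cover F"
  shows "min_zero_forcing_set G (sources F)"
proof -
  note F = max_coverD[OF assms]
  have "zero_forcing_number G = card (sources F)"
    unfolding zero_forcing_number_def
  proof (rule Least_equality)
    show "\<exists>B. zero_forcing_set G B \<and> card B = card (sources F)"
      using zero_forcing_sources[OF F(1)] by blast
  next
    fix k assume "\<exists>B. zero_forcing_set G B \<and> card B = k"
    then obtain F' where "path_cover F'" "card (sources F') = k"
      using zero_forcing_set_path_cover by metis
    then show "card (sources F) \<le> k"
      using F card_sources[OF F(1)] card_sources[of F'] by fastforce
  qed
  with zero_forcing_sources[OF F(1)] show ?thesis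
    by (simp add: min_zero_forcing_set_def)
qed

lemma path_cover_mono: "path_cover F \<Longrightarrow> F' \<subseteq> F \<Longrightarrow> path_cover F'"
  unfolding path_cover_def using single_valued_subset converse_mono by blast

text \<open>Joins the path ending in \<open>x\<close> to the one starting in \<open>y\<close>. The
  last premise prevents adding the reverse of a single-arc path; longer paths cannot be closed in a
  forest.\<close>

lemma path_cover_insert:
  assumes "path_cover F" "(x, y) \<in> parcs G" "x \<in> sinks F" "y \<in> sources F" "(y, x) \<notin> F"
  shows "path_cover (insert (x, y) F)"
  using assms pair_no_loops[OF assms(2)]
  by (auto simp: path_cover_def single_valued_def sinks_def sources_def)

subsection \<open>Reversing paths of a cover\<close>

text \<open>On the vertices of \<open>G\<close> such a \<open>C\<close> is a union of whole paths,
  so several paths can be reversed at once.\<close>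

definition component_closed :: "('a \<times> 'a) set \<Rightarrow> 'a set \<Rightarrow> bool" where
  "component_closed F C \<longleftrightarrow> (\<forall>(x, y)\<in>F. x \<in> C \<longleftrightarrow> y \<in> C)"

definition flip :: "'a set \<Rightarrow> ('a \<times> 'a) set \<Rightarrow> ('a \<times> 'a) set" where
  "flip C F = {(x, y). (x, y) \<in> F \<and> x \<notin> C} \<union> {(y, x). (x, y) \<in> F \<and> x \<in> C}"

text \<open>Arcs inside and outside \<open>C\<close> share no vertex, so reversing the former
  preserves the conditions on a cover. Within \<open>C\<close> the old sinks become the new
  sources.\<close>

lemma flip:
  assumes "path_cover F" "component_closed F C"
  shows path_cover_flip: "path_cover (flip C F)"
    and card_flip: "card (flip C F) = card F"
    and sources_flip: "sources (flip C F) = (sources F - C) \<union> (sinks F \<inter> C)"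
proof -
  note F = path_coverD[OF assms(1)]
  have C: "x \<in> C \<longleftrightarrow> y \<in> C" if "(x, y) \<in> F" for x y
    using assms(2) that by (auto simp: component_closed_def)
  show "path_cover (flip C F)"
    unfolding path_cover_def
  proof (intro conjI allI impI)
    show "flip C F \<subseteq> parcs G"
      using F(1) by (auto simp: flip_def dest: arcs_symmetric)
    show "single_valued (flip C F)" "single_valued ((flip C F)\<inverse>)"
      using C F(4,5) by (auto simp: flip_def single_valued_def)
    fix x y assume "(x, y) \<in> flip C F"
    then show "(y, x) \<notin> flip C F"
      using C F(3) by (auto simp: flip_def)
  qed
  have "flip C F = (\<lambda>(x, y). if x \<in> C then (y, x) else (x, y)) ` F"
  proof (intro equalityI subrelI)
    fix x y assume "(x, y) \<in> flip C F"
    then consider "(x, y) \<in> F" "x \<notin> C" | "(y, x) \<in> F" "y \<in> C"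
      by (auto simp: flip_def)
    then show "(x, y) \<in> (\<lambda>(x, y). if x \<in> C then (y, x) else (x, y)) ` F"
      by cases force+
  qed (auto simp: flip_def split: if_splits)
  moreover have "inj_on (\<lambda>(x, y). if x \<in> C then (y, x) else (x, y)) F"
  proof (rule inj_onI, clarify)
    fix x y x' y' assume "(x, y) \<in> F" "(x', y') \<in> F"
      "(if x \<in> C then (y, x) else (x, y)) = (if x' \<in> C then (y', x') else (x', y'))"
    then show "x = x' \<and> y = y'"
      using C[of x y] C[of x' y'] by (auto split: if_splits)
  qed
  ultimately show "card (flip C F) = card F"
    by (simp add: card_image)
  show "sources (flip C F) = (sources F - C) \<union> (sinks F \<inter> C)"
    using C by (auto simp: sources_def sinks_def flip_def)
qed

lemma max_cover_flip:
  "max_cover F \<Longrightarrow> component_closed F C \<Longrightarrow> max_cover (flip C F)"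
  using max_cover_card_eq max_coverD(1) path_cover_flip card_flip by blast

text \<open>Closure against the direction of the arcs holds because predecessors are unique and
  \<open>s\<close> has none.\<close>

lemma component_closed_source:
  assumes "path_cover F" "s \<in> sources F"
  shows "component_closed F (F\<^sup>* `` {s})"
proof -
  note F = path_coverD[OF assms(1)]
  have "(s, x) \<in> F\<^sup>*" if "(x, y) \<in> F" "(s, y) \<in> F\<^sup>*" for x y
    using that(2,1) assms(2) F(5) by (cases rule: rtranclE) (auto simp: sources_def)
  then show ?thesis
    by (auto simp: component_closed_def intro: rtrancl_into_rtrancl)
qed

lemma component_closed_Un:
  "component_closed F C \<Longrightarrow> component_closed F D \<Longrightarrow> component_closed F (C \<union> D)"
  by (auto simp: component_closed_def)

lemma component_closed_rtrancl:
  assumes "component_closed F C" "(x, y) \<in> F\<^sup>*"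
  shows "x \<in> C \<longleftrightarrow> y \<in> C"
  using assms(2) by induction (use assms(1) in \<open>auto simp: component_closed_def\<close>)

lemma sources_component:
  "s \<in> sources F \<Longrightarrow> sources F \<inter> F\<^sup>* `` {s} = {s}"
  using source_rtrancl by fastforce

text \<open>Reversing the path of \<open>s\<close> preserves the number of sources.\<close>
lemma sinks_component:
  assumes "path_cover F" "s \<in> sources F"
  obtains t where "sinks F \<inter> F\<^sup>* `` {s} = {t}"
proof -
  let ?C = "F\<^sup>* `` {s}"
  note closed = component_closed_source[OF assms]
  have fin: "finite (sources F)" "finite (sinks F)"
    using pair_finite_verts by (auto simp: sources_def sinks_def)
  have "card (sources (flip ?C F)) = card (sources F)"
    using card_sources[OF assms(1)] card_sources[OF path_cover_flip[OF assms(1) closed]]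
      card_flip[OF assms(1) closed] by simp
  moreover have "card (sources (flip ?C F)) = card (sources F - ?C) + card (sinks F \<inter> ?C)"
    unfolding sources_flip[OF assms(1) closed] using fin by (intro card_Un_disjoint) auto
  moreover have "card (sources F) = card (sources F - ?C) + card (sources F \<inter> ?C)"
    using fin card_Int_Diff[of "sources F" ?C] by simp
  ultimately have "card (sinks F \<inter> ?C) = 1"
    using sources_component[OF assms(2)] by simp
  with that show thesis
    by (auto simp: card_1_singleton_iff)
qed

subsection \<open>Short cycles in the zero forcing graph\<close>

lemma zero_forcing_graph_arcI:
  assumes "min_zero_forcing_set G (insert x R)" "min_zero_forcing_set G (insert y R)"
    and "x \<notin> R" "y \<notin> R" "x \<noteq> y"
  shows "(insert x R, insert y R) \<in> parcs (zero_forcing_graph G)"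
proof -
  have "(insert x R - insert y R) \<union> (insert y R - insert x R) = {x, y}"
    using assms(3-5) by auto
  with assms show ?thesis
    by (simp add: zero_forcing_graph_def)
qed

lemma contains_C3:
  assumes "min_zero_forcing_set G (insert x (insert y R))"
    "min_zero_forcing_set G (insert y (insert z R))"
    "min_zero_forcing_set G (insert z (insert x R))"
    and "distinct [x, y, z]" "x \<notin> R" "y \<notin> R" "z \<notin> R"
  shows "contains_subgraph (zero_forcing_graph G) (cycle_graph 3)"
proof -
  let ?A = "insert x (insert y R)" and ?B = "insert y (insert z R)" and ?C = "insert z (insert x R)"
  have "(?A, ?B) \<in> parcs (zero_forcing_graph G)"
    using zero_forcing_graph_arcI[of x "insert y R" z] assms by (auto simp: insert_commute)
  moreover have "(?B, ?C) \<in> parcs (zero_forcing_graph G)"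
    using zero_forcing_graph_arcI[of y "insert z R" x] assms by (auto simp: insert_commute)
  moreover have "(?C, ?A) \<in> parcs (zero_forcing_graph G)"
    using zero_forcing_graph_arcI[of z "insert x R" y] assms by (auto simp: insert_commute)
  moreover have "distinct [?A, ?B, ?C]"
    using assms(4-7) by auto
  ultimately show ?thesis
    using contains_cycle_listI[OF pair_graph_zero_forcing_graph[OF pair_graph_axioms],
        of "[?A, ?B, ?C]"]
    by (simp add: eval_nat_numeral)
qed

lemma contains_C4:
  assumes "min_zero_forcing_set G (insert s (insert s' R))"
    "min_zero_forcing_set G (insert t (insert s' R))"
    "min_zero_forcing_set G (insert t (insert t' R))"
    "min_zero_forcing_set G (insert s (insert t' R))"
    and "distinct [s, s', t, t']" "s \<notin> R" "s' \<notin> R" "t \<notin> R" "t' \<notin> R"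
  shows "contains_subgraph (zero_forcing_graph G) (cycle_graph 4)"
proof -
  let ?A = "insert s (insert s' R)" and ?B = "insert t (insert s' R)"
    and ?C = "insert t (insert t' R)" and ?D = "insert s (insert t' R)"
  have "(?A, ?B) \<in> parcs (zero_forcing_graph G)"
    using zero_forcing_graph_arcI[of s "insert s' R" t] assms by auto
  moreover have "(?B, ?C) \<in> parcs (zero_forcing_graph G)"
    using zero_forcing_graph_arcI[of s' "insert t R" t'] assms by (auto simp: insert_commute)
  moreover have "(?C, ?D) \<in> parcs (zero_forcing_graph G)"
    using zero_forcing_graph_arcI[of t "insert t' R" s] assms by auto
  moreover have "(?D, ?A) \<in> parcs (zero_forcing_graph G)"
    using zero_forcing_graph_arcI[of t' "insert s R" s'] assms by (auto simp: insert_commute)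
  moreover have "distinct [?A, ?B, ?C, ?D]"
    using assms(5-9) by auto
  ultimately show ?thesis
    using contains_cycle_listI[OF pair_graph_zero_forcing_graph[OF pair_graph_axioms],
        of "[?A, ?B, ?C, ?D]"]
    by (simp add: eval_nat_numeral)
qed

text \<open>Being no sinks, \<open>s\<close> and \<open>s'\<close> start nontrivial paths; reversing
  none, one or both of them yields the four sets of the cycle.\<close>

lemma two_paths_C4:
  assumes F: "max_cover F" and s: "s \<in> sources F" "s \<notin> sinks F"
    and s': "s' \<in> sources F" "s' \<notin> sinks F" and "s \<noteq> s'"
  shows "contains_subgraph (zero_forcing_graph G) (cycle_graph 4)"
proof -
  let ?C = "F\<^sup>* `` {s}" and ?C' = "F\<^sup>* `` {s'}"
  note cover = max_coverD(1)[OF F]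
  note closed = component_closed_source[OF cover s(1)] component_closed_source[OF cover s'(1)]
  obtain t where t: "sinks F \<inter> ?C = {t}"
    using sinks_component[OF cover s(1)] .
  obtain t' where t': "sinks F \<inter> ?C' = {t'}"
    using sinks_component[OF cover s'(1)] .
  \<comment> \<open>A common vertex would put \<open>s\<close> on the path of \<open>s'\<close>,
    although \<open>s\<close> has no predecessor.\<close>
  have disj: "?C \<inter> ?C' = {}"
    using component_closed_rtrancl[OF closed(2)] source_rtrancl[OF s(1)] \<open>s \<noteq> s'\<close> by blast
  define R where "R = sources F - {s, s'}"
  note src = sources_component[OF s(1)] sources_component[OF s'(1)]
  have "sources F = insert s (insert s' R)"
    using s s' by (auto simp: R_def)
  moreover have "sources (flip ?C F) = insert t (insert s' R)"
    unfolding sources_flip[OF cover closed(1)] t using src s'(1) \<open>s \<noteq> s'\<close>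
    by (auto simp: R_def)
  moreover have "sources (flip ?C' F) = insert s (insert t' R)"
    unfolding sources_flip[OF cover closed(2)] t' using src s(1) \<open>s \<noteq> s'\<close>
    by (auto simp: R_def)
  moreover have "sources (flip (?C \<union> ?C') F) = insert t (insert t' R)"
    unfolding sources_flip[OF cover component_closed_Un[OF closed]] Int_Un_distrib t t'
    using src by (auto simp: R_def)
  moreover note min_zero_forcing_set_sources[OF F]
    min_zero_forcing_set_sources[OF max_cover_flip[OF F closed(1)]]
    min_zero_forcing_set_sources[OF max_cover_flip[OF F closed(2)]]
    min_zero_forcing_set_sources[OF max_cover_flip[OF F component_closed_Un[OF closed]]]
  moreover have "t \<noteq> t'" "t \<noteq> s'" "t' \<noteq> s" "t \<noteq> s" "t' \<noteq> s'"
    using disj t t' s s' by blast+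
  moreover have "s \<notin> R" "s' \<notin> R" "t \<notin> R" "t' \<notin> R"
    using t t' src by (auto simp: R_def)
  ultimately show ?thesis
    using \<open>s \<noteq> s'\<close> by (intro contains_C4[of s s' R t t']) simp_all
qed

text \<open>
  By maximality \<open>w\<close> is an inner vertex of its path, from \<open>s\<close> to \<open>t\<close> say. Besides reversing
  this path one can cut it behind \<open>w\<close> and append \<open>v\<close> to the part ending in \<open>w\<close>, so any two of
  \<open>s\<close>, \<open>t\<close>, \<open>v\<close> serve as sources.
\<close>
lemma isolated_source_C3:
  assumes F: "max_cover F" and v: "v \<in> sources F" "v \<in> sinks F" and vw: "(v, w) \<in> parcs G"
  shows "contains_subgraph (zero_forcing_graph G) (cycle_graph 3)"
proof -
  note cover = max_coverD(1)[OF F] and max = max_coverD(2)[OF F]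
  note FD = path_coverD[OF cover]
  have wv: "(w, v) \<in> parcs G" and "w \<in> pverts G"
    using vw by (auto dest: arcs_symmetric in_arcsD2)
  have v_notin: "(x, v) \<notin> F" "(v, x) \<notin> F" for x
    using v by (auto simp: sources_def sinks_def)
  \<comment> \<open>Otherwise \<open>v\<close> could be joined to an end of the path of
    \<open>w\<close>, giving a cover with more arcs.\<close>
  have "w \<notin> sources F" "w \<notin> sinks F"
    using max[of "insert (v, w) F"] path_cover_insert[OF cover vw v(2)]
      max[of "insert (w, v) F"] path_cover_insert[OF cover wv _ v(1)]
      v_notin FD(2) by (auto simp: card_insert_if)
  then obtain a b where a: "(a, w) \<in> F" and b: "(w, b) \<in> F"
    using \<open>w \<in> pverts G\<close> by (auto simp: sources_def sinks_def)
  obtain s where s: "s \<in> sources F" "(s, w) \<in> F\<^sup>*"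
    using path_cover_source[OF cover \<open>w \<in> pverts G\<close>] .
  let ?C = "F\<^sup>* `` {s}"
  obtain t where t: "sinks F \<inter> ?C = {t}"
    using sinks_component[OF cover s(1)] .
  note closed = component_closed_source[OF cover s(1)] and src = sources_component[OF s(1)]
  have "v \<notin> ?C"
  proof
    assume "v \<in> ?C"
    then have "s = v" using v(1) src by auto
    then have "w = v" using s(2) v_notin by (auto elim: converse_rtranclE)
    then show False using pair_no_loops[OF vw] by simp
  qed
  have "s \<notin> sinks F"
    using s a b \<open>w \<notin> sources F\<close> by (auto simp: sinks_def elim: converse_rtranclE)

  define F' where "F' = insert (w, v) (F - {(w, b)})"
  have "path_cover F'"
    unfolding F'_def
  proof (rule path_cover_insert)
    show "path_cover (F - {(w, b)})"
      using cover by (rule path_cover_mono) auto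
    show "w \<in> sinks (F - {(w, b)})" "v \<in> sources (F - {(w, b)})"
      using FD(4) b \<open>w \<in> pverts G\<close> v(1) by (auto simp: sinks_def sources_def)
  qed (use wv v_notin in auto)
  moreover have "card F' = card F"
    unfolding F'_def using b v_notin FD(2) card_Suc_Diff1[OF FD(2) b] by simp
  ultimately have F': "max_cover F'"
    using F max_cover_card_eq by blast
  note cover' = max_coverD(1)[OF F']

  \<comment> \<open>The part cut off behind \<open>w\<close> is a path of \<open>F'\<close> starting
    in \<open>b\<close>. Reversing it replaces the source \<open>b\<close> by
    \<open>t\<close>.\<close>
  let ?D = "F\<^sup>* `` {b}"
  have "w \<notin> ?D"
    using path_cover_acyclic[OF cover] b by (auto simp: acyclic_def dest: rtrancl_into_trancl2)
  have "v \<notin> ?D"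
    using v_notin b by (auto elim: rtranclE)
  have closed': "component_closed F' ?D"
    unfolding component_closed_def
  proof (intro ballI, clarify)
    fix x y assume xy: "(x, y) \<in> F'"
    show "x \<in> ?D \<longleftrightarrow> y \<in> ?D"
    proof (cases "(x, y) = (w, v)")
      case True
      with \<open>w \<notin> ?D\<close> \<open>v \<notin> ?D\<close> show ?thesis by simp
    next
      case False
      with xy have xy: "(x, y) \<in> F" "(x, y) \<noteq> (w, b)" by (auto simp: F'_def)
      have "x \<in> ?D" if "y \<in> ?D"
      proof -
        from that have "(b, y) \<in> F\<^sup>*" by simp
        then show ?thesis
          using xy b FD(5) by (cases rule: rtranclE) auto
      qed
      with xy(1) show ?thesis
        by (auto intro: rtrancl_into_rtrancl)
    qed
  qed
  have "sources F' = insert b (sources F - {v})"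
    using FD(5) FD(6)[OF b] b v_notin by (auto simp: F'_def sources_def)
  moreover have "sinks F' = sinks F"
    using b by (auto simp: F'_def sinks_def)
  moreover have "sources F \<inter> ?D = {}"
    using source_rtrancl b by (auto simp: sources_def)
  moreover have "sinks F \<inter> ?D \<subseteq> {t}"
    using t s(2) b by (auto intro: rtrancl_trans rtrancl_into_rtrancl)
  ultimately have src': "sources (flip ?D F') = sources F - {v} \<union> (sinks F \<inter> ?D)"
    unfolding sources_flip[OF cover' closed'] by auto
  note min = min_zero_forcing_set_sources[OF F]
    min_zero_forcing_set_sources[OF max_cover_flip[OF F closed]]
    min_zero_forcing_set_sources[OF max_cover_flip[OF F' closed']]
  \<comment> \<open>Both source sets are minimum zero forcing sets, so the loss of \<open>v\<close>
    must be made up by a sink in \<open>?D\<close>, which can only be \<open>t\<close>.\<close>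
  have "card (sources F) = card (sources (flip ?D F'))"
    using min(1,3) by (simp add: min_zero_forcing_set_def)
  moreover have "card (sources F - {v}) < card (sources F)"
    using v(1) pair_finite_verts by (intro card_Diff1_less) (auto simp: sources_def)
  ultimately have "sinks F \<inter> ?D \<noteq> {}"
    unfolding src' by auto
  with \<open>sinks F \<inter> ?D \<subseteq> {t}\<close> have "sinks F \<inter> ?D = {t}"
    by auto

  define R where "R = sources F - {s, v}"
  have "s \<noteq> v" "s \<noteq> t" "t \<noteq> v"
    using t \<open>v \<notin> ?C\<close> \<open>s \<notin> sinks F\<close> by auto
  moreover have "s \<notin> R" "v \<notin> R" "t \<notin> R"
    using t src by (auto simp: R_def)
  moreover have "sources F = insert s (insert v R)"
    using s v by (auto simp: R_def)
  moreover have "sources (flip ?C F) = insert v (insert t R)"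
    unfolding sources_flip[OF cover closed] t using src v(1) \<open>s \<noteq> v\<close> by (auto simp: R_def)
  moreover have "sources (flip ?D F') = insert t (insert s R)"
    unfolding src' \<open>sinks F \<inter> ?D = {t}\<close> using s(1) \<open>s \<noteq> v\<close> by (auto simp: R_def)
  ultimately show ?thesis
    using min by (intro contains_C3[of s v R t]) simp_all
qed

subsection \<open>Paths\<close>

text \<open>The single path of the cover contains all vertices, and any arc of \<open>G\<close>
  between two of its non-consecutive vertices would close a cycle.\<close>

lemma is_path_if_single_source:
  assumes cover: "path_cover F" and s: "sources F = {s}"
  shows "is_path G"
proof -
  note F = path_coverD[OF cover]
  \<comment> \<open>\<open>P n\<close> asks for a chain of \<open>n\<close> vertices along
    \<open>F\<close> from \<open>s\<close>. A longest one is closed under successors and therefore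
    reaches every vertex.\<close>
  define P where "P n \<longleftrightarrow> n \<ge> 1 \<and> (\<exists>g. inj_on g {..<n} \<and> g 0 = s \<and>
    (\<forall>i. Suc i < n \<longrightarrow> (g i, g (Suc i)) \<in> F))" for n :: nat
  have "s \<in> pverts G"
    using s by (auto simp: sources_def)
  have chain_in_verts: "g ` {..<n} \<subseteq> pverts G"
    if "g 0 = s" "\<And>i. Suc i < n \<Longrightarrow> (g i, g (Suc i)) \<in> F" for g n
  proof clarsimp
    fix i assume "i < n"
    with that F(6) \<open>s \<in> pverts G\<close> show "g i \<in> pverts G"
      by (cases i) auto
  qed
  have "n \<le> card (pverts G)" if "P n" for n
  proof -
    from that obtain g where "inj_on g {..<n}" "g ` {..<n} \<subseteq> pverts G"
      using chain_in_verts by (auto simp: P_def)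
    then show ?thesis
      using card_inj_on_le[OF _ _ pair_finite_verts] by fastforce
  qed
  moreover have "P 1"
    by (auto simp: P_def lessThan_Suc intro!: exI[of _ "\<lambda>_. s"])
  ultimately obtain n where n: "P n" and max: "\<And>m. P m \<Longrightarrow> m \<le> n"
    using Nat.ex_has_greatest_nat[of P 1 "card (pverts G)"] by auto
  then obtain g where g: "n \<ge> 1" "inj_on g {..<n}" "g 0 = s"
    "\<And>i. Suc i < n \<Longrightarrow> (g i, g (Suc i)) \<in> F"
    by (auto simp: P_def)
  have step: "y \<in> g ` {..<n}" if "i < n" "(g i, y) \<in> F" for i y
  proof (cases "Suc i < n")
    case True
    with g(4)[OF True] F(4) that show ?thesis by blast
  next
    case False
    show ?thesis
    proof (rule ccontr)
      assume y: "y \<notin> g ` {..<n}"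
      have "inj_on (g(n := y)) {..<Suc n}"
        using g(2) y by (auto simp: lessThan_Suc inj_on_def)
      moreover have "((g(n := y)) j, (g(n := y)) (Suc j)) \<in> F" if "Suc j < Suc n" for j
        using that \<open>i < n\<close> False \<open>(g i, y) \<in> F\<close> g(4)[of j] by (cases "j = i") auto
      ultimately have "P (Suc n)"
        unfolding P_def using g(1,3) by (intro conjI exI[of _ "g(n := y)"]) auto
      then show False
        using max by fastforce
    qed
  qed
  have "v \<in> g ` {..<n}" if "v \<in> pverts G" for v
  proof -
    have "(s, v) \<in> F\<^sup>*"
      using path_cover_source[OF cover that] s by auto
    then show ?thesis
    proof induction
      case base
      show ?case using g(1,3) by (intro image_eqI[of _ _ 0]) auto
    qed (use step in auto)
  qed
  then have verts: "pverts G = g ` {..<n}"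
    using chain_in_verts[OF g(3,4)] by auto
  \<comment> \<open>An arc skipping ahead from \<open>g i\<close> to \<open>g j\<close> would form a
    cycle with the chain between them.\<close>
  have consecutive: "j \<le> Suc i" if "(g i, g j) \<in> parcs G" "j < n" for i j
  proof (rule ccontr)
    assume "\<not> j \<le> Suc i"
    moreover have "inj_on (\<lambda>k. g (i + k)) {..<Suc j - i}"
    proof (rule inj_onI)
      fix k l assume "k \<in> {..<Suc j - i}" "l \<in> {..<Suc j - i}" "g (i + k) = g (i + l)"
      then show "k = l"
        using inj_onD[OF g(2), of "i + k" "i + l"] that(2) by auto
    qed
    moreover have "(g (i + k), g (i + Suc k)) \<in> parcs G" if "Suc k < Suc j - i" for k
      using g(4)[of "i + k"] F(1) that \<open>j < n\<close> by auto
    ultimately have "(g (i + (Suc j - i - 1)), g (i + 0)) \<notin> parcs G"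
      by (intro no_closed_path[of "\<lambda>k. g (i + k)"]) auto
    then show False
      using arcs_symmetric[OF that(1)] \<open>\<not> j \<le> Suc i\<close> by simp
  qed
  have "parcs G = map_prod g g ` parcs (path_graph n)"
  proof (intro equalityI subrelI)
    fix x y assume xy: "(x, y) \<in> parcs G"
    then obtain i j where ij: "i < n" "j < n" "x = g i" "y = g j"
      using in_arcsD1[OF xy] in_arcsD2[OF xy] unfolding verts by blast
    moreover have "i \<noteq> j"
      using pair_no_loops[OF xy] ij by auto
    ultimately have "j = i + 1 \<or> i = j + 1"
      using consecutive[of i j] consecutive[of j i] xy arcs_symmetric[OF xy] by auto
    with ij show "(x, y) \<in> map_prod g g ` parcs (path_graph n)"
      by (auto simp: path_graph_def)
  next
    fix x y assume "(x, y) \<in> map_prod g g ` parcs (path_graph n)"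
    then consider i where "Suc i < n" "x = g i" "y = g (Suc i)"
      | i where "Suc i < n" "y = g i" "x = g (Suc i)"
      by (auto simp: path_graph_def)
    then show "(x, y) \<in> parcs G"
      by cases (use g(4) F(1) arcs_symmetric in blast)+
  qed
  moreover have "pair_wf_digraph (path_graph n)"
    using pair_graph_path_graph[of n] by (simp add: pair_graph_def pair_digraph_def pair_fin_digraph_def)
  ultimately show ?thesis
    unfolding is_path_def using g(1,2) verts
    by (auto simp: digraph_iso_with_proj_iff path_graph_def intro!: exI[of _ n] exI[of _ g])
qed

text \<open>Orienting the path from \<open>f 0\<close> gives a cover with one source, so minimum
  zero forcing sets are singletons. An inner vertex has two white neighbours and cannot
  force.\<close>

lemma zero_forcing_graph_of_path:
  assumes "is_path G"
  shows "card (pverts (zero_forcing_graph G)) \<le> 2"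
proof -
  obtain n where "n \<ge> 1" and iso: "digraph_iso (with_proj (path_graph n)) (with_proj G)"
    using assms by (auto simp: is_path_def)
  interpret P: pair_graph "path_graph n"
    by (rule pair_graph_path_graph)
  obtain f where inj: "inj_on f {..<n}" and verts: "pverts G = f ` {..<n}"
    and "parcs G = map_prod f f ` parcs (path_graph n)"
    using iso unfolding digraph_iso_with_proj_iff[OF P.pair_wf_digraph_axioms]
    by (auto simp: path_graph_def)
  then have arc: "(f i, f (Suc i)) \<in> parcs G" if "Suc i < n" for i
    using that by (force simp: path_graph_def)
  have f_eq: "f i = f j \<longleftrightarrow> i = j" if "i < n" "j < n" for i j
    using inj that by (auto simp: inj_on_def)

  define F where "F = {(f i, f (Suc i)) | i. Suc i < n}"
  have "path_cover F"
    unfolding path_cover_def using arc f_eq by (auto simp: F_def single_valued_def)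
  moreover have "sources F = {f 0}"
  proof -
    have "f i \<in> Range F \<longleftrightarrow> i \<noteq> 0" if "i < n" for i
    proof (cases i)
      case 0
      with that f_eq[of 0] show ?thesis
        by (auto simp: F_def)
    next
      case (Suc k)
      with that have "(f k, f i) \<in> F"
        by (auto simp: F_def)
      with Suc show ?thesis by auto
    qed
    with \<open>n \<ge> 1\<close> show ?thesis
      by (auto simp: sources_def verts)
  qed
  ultimately have "zero_forcing_set G {f 0}"
    using zero_forcing_sources by metis
  then have "zero_forcing_number G \<le> 1"
    unfolding zero_forcing_number_def by (intro Least_le) (auto intro!: exI[of _ "{f 0}"])
  have "B \<in> {{f 0}, {f (n - 1)}}" if "min_zero_forcing_set G B" for B
  proof -
    have B: "zero_forcing_set G B" "card B \<le> 1"
      using that \<open>zero_forcing_number G \<le> 1\<close> by (auto simp: min_zero_forcing_set_def)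
    obtain F' where F': "path_cover F'" "sources F' = B"
      using zero_forcing_set_path_cover[OF B(1)] .
    have "f 0 \<in> pverts G"
      using verts \<open>n \<ge> 1\<close> by auto
    \<comment> \<open>A cover of a nonempty vertex set has a source.\<close>
    then have "B \<noteq> {}"
      using path_cover_source[OF F'(1)] F'(2) by blast
    moreover have "finite B"
      using F'(2) pair_finite_verts by (auto simp: sources_def)
    ultimately obtain x where x: "B = {x}"
      using B(2) by (metis One_nat_def card_1_singletonE card_gt_0_iff le_antisym Suc_leI)
    then obtain i where i: "x = f i" "i < n"
      using B(1) verts by (auto simp: zero_forcing_set_def)
    have "i = 0 \<or> i = n - 1"
    proof (rule ccontr)
      assume "\<not> (i = 0 \<or> i = n - 1)"
      then obtain k where k: "i = Suc k" "Suc i < n"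
        using i(2) by (cases i) auto
      have nbs: "(x, f k) \<in> parcs G" "(x, f (Suc i)) \<in> parcs G"
        using arc[of k] arc[of i] k i arcs_symmetric by auto
      have neq: "f k \<noteq> x" "f (Suc i) \<noteq> x" "f k \<noteq> f (Suc i)"
        using k i f_eq by auto
      have "(color_change G)\<^sup>*\<^sup>* {x} (pverts G)"
        using B(1) x by (simp add: zero_forcing_set_def)
      then consider "{x} = pverts G" | S where "color_change G {x} S"
        by (auto elim: converse_rtranclpE)
      then show False
      proof cases
        case 1
        with neq(1) nbs(1) show False
          by (auto dest: in_arcsD2)
      next
        case 2
        then obtain w where w: "{y. (x, y) \<in> parcs G \<and> y \<notin> {x}} = {w}"
          by (auto simp: color_change.simps)
        have "f k \<in> {w}" "f (Suc i) \<in> {w}"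
          using nbs neq(1,2) by (auto simp: w[symmetric])
        with neq(3) show False by simp
      qed
    qed
    with x i show ?thesis by auto
  qed
  then have "pverts (zero_forcing_graph G) \<subseteq> {{f 0}, {f (n - 1)}}"
    by (auto simp: zero_forcing_graph_def)
  from card_mono[OF _ this] show ?thesis
    by (auto simp: card_insert_if split: if_splits)
qed

end

theorem theorem5p4:
  fixes T :: "'a pair_pre_digraph"
  assumes "is_tree T"
  shows "(\<forall>n\<in>{3, 4}. \<not> contains_subgraph (zero_forcing_graph T) (cycle_graph n)) \<longleftrightarrow> is_path T"
proof -
  interpret pair_graph T
    using assms by (simp add: is_tree_def)
  interpret pair_forest T
    by unfold_locales (use assms in \<open>auto simp: is_tree_def\<close>)
  interpret Z: pair_graph "zero_forcing_graph T"
    by (rule pair_graph_zero_forcing_graph) (rule pair_graph_axioms)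
  have conn: "strongly_connected (with_proj (mk_symmetric (with_proj T)))"
    using assms by (simp add: is_tree_def connected_def)
  show ?thesis
  proof
    assume "is_path T"
    then have "card (pverts (zero_forcing_graph T)) \<le> 2"
      by (rule zero_forcing_graph_of_path)
    then show "\<forall>n\<in>{3, 4}. \<not> contains_subgraph (zero_forcing_graph T) (cycle_graph n)"
      using contains_cycleD[OF _ _ Z.pair_finite_verts] by fastforce
  next
    assume free: "\<forall>n\<in>{3, 4}. \<not> contains_subgraph (zero_forcing_graph T) (cycle_graph n)"
    obtain F where F: "max_cover F"
      by (rule exists_max_cover)
    note cover = max_coverD(1)[OF F]
    obtain v where "v \<in> pverts T"
      using conn by (auto simp: strongly_connected_def)
    then obtain s where s: "s \<in> sources F"
      using path_cover_source[OF cover] by blast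
    have "sources F = {s}"
    proof (rule ccontr)
      assume "sources F \<noteq> {s}"
      then obtain s' where s': "s' \<in> sources F" "s' \<noteq> s"
        using s by blast
      \<comment> \<open>A source that is also a sink is a trivial path. Connectedness gives it a
        neighbour as soon as there is a second vertex, which produces a triangle.\<close>
      have "x \<notin> sinks F" if "x \<in> sources F" "y \<in> sources F" "x \<noteq> y" for x y
      proof
        assume x: "x \<in> sinks F"
        have "x \<rightarrow>\<^sup>*\<^bsub>with_proj (mk_symmetric (with_proj T))\<^esub> y"
          using conn that by (auto simp: strongly_connected_def sources_def)
        then have "x \<rightarrow>\<^sup>*\<^bsub>with_proj T\<^esub> y"
          by (simp add: reachable_mk_symmetric_eq[OF pair_sym_arcs])
        then obtain w where "(x, w) \<in> parcs T"
          using \<open>x \<noteq> y\<close> by (auto elim: converse_reachable_cases)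
        then show False
          using isolated_source_C3[OF F \<open>x \<in> sources F\<close> x] free by auto
      qed
      then show False
        using two_paths_C4[OF F s _ s'(1)] s s' free by auto
    qed
    then show "is_path T"
      using is_path_if_single_source[OF cover] by blast
  qed
qed

end
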